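(* Let $(Q;\cdot)$ be a group isotope, let $0\in Q$, and let $x\cdot y=\alpha x+a+\beta y$ be its ($0$-)canonical decomposition, with decomposition group $(Q;+)$. Then: - $(Q;\cdot)$ is strictly commutative, i.e. $\mathrm{Sym}(\cdot)=\{\iota,s\}$, if and only if $(Q;+)$ is abelian and $\beta=\alpha\neq-\iota$; - $(Q;\cdot)$ is strictly left symmetric, i.e. $\mathrm{Sym}(\cdot)=\{\iota,r\}$, if and only if $(Q;+)$ is abelian and $\beta=-\iota\neq\alpha$; - $(Q;\cdot)$ is strictly right symmetric, i.e. $\mathrm{Sym}(\cdot)=\{\iota,\ell\}$, if and only if $(Q;+)$ is abelian and $\alpha=-\iota\neq\beta$; - $(Q;\cdot)$ is strictly semi-symmetric, i.e. $\mathrm{Sym}(\cdot)=A_3$, if and only if $\alpha$ is an anti-automorphism of $(Q;+)$, $\beta=\alpha^{-1}$, $\alpha a=-a$, $\alpha^3=-I_a^{-1}$ where $I_a(x):=-a+x+a$, and moreover $(Q;+)$ is non-abelian or $\alpha\neq-\iota$; - $(Q;\cdot)$ is totally symmetric, i.e. $\mathrm{Sym}(\cdot)=S_3$, if and only if $(Q;+)$ is abelian and $\alpha=\beta=-\iota$; - $(Q;\cdot)$ is asymmetric, i.e. $\mathrm{Sym}(\cdot)=\{\iota\}$, if and only if (at least one of the following holds: $\alpha$ is not an anti-automorphism of $(Q;+)$, $\beta\neq\alpha^{-1}$, $\alpha^3\neq-I_a^{-1}$, $\alpha a\neq-a$) and ($(Q;+)$ is non-abelian, or the three inequalities $\alpha\neq-\iota$,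 $\alpha\neq\beta$, $\beta\neq-\iota$ all hold). In particular, these six (pairwise disjoint) classes partition the set of all isotopes, defined on $Q$, of any given group on $Q$.
   Context: A quasigroup is a groupoid $(Q;\cdot)$ in which each equation $x\cdot a=b$, $a\cdot y=b$ has a unique solution. For $\sigma\in S_3$, the $\sigma$-parastrophe of $(\cdot)$ is the operation $\stackrel{\sigma}{\cdot}$ defined by $x_{1\sigma}\stackrel{\sigma}{\cdot}x_{2\sigma}=x_{3\sigma}\Leftrightarrow x_1\cdot x_2=x_3$. The symmetry group $\mathrm{Sym}(\cdot)$ is the set of $\sigma\in S_3$ with $(\stackrel{\sigma}{\cdot})=(\cdot)$. Put $s=(12)$, $\ell=(13)$, $r=(23)$. A quasigroup is commutative if $s\in\mathrm{Sym}(\cdot)$ ($xy=yx$); left symmetric if $r\in\mathrm{Sym}(\cdot)$ ($x\cdot xy=y$); right symmetric if $\ell\in\mathrm{Sym}(\cdot)$ ($xy\cdot y=x$); semi-symmetric if $\mathrm{Sym}(\cdot)\supseteq A_3$ ($x\cdot yx=y$); totally symmetric if $\mathrm{Sym}(\cdot)=S_3$; asymmetric if $\mathrm{Sym}(\cdot)=\{\iota\}$. The word "strictly" before one of these properties means that the quasigroup has the property but is not totally symmetric. A group isotope is a groupoid $(Q;\cdot)$ of the form $x\cdot y=\gamma^{-1}(\alpha x+\beta y)$ for some group $(Q;+)$ (not necessarily commutative) and bijections $\alpha,\beta,\gamma$ of $Q$. A $0$-canonical decomposition of a group isotope $(Q;\cdot)$ is a representation $x\cdot y=\alpha x+a+\beta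 y$, where $(Q;+)$ is a group with neutral element $0$, $a\in Q$, and $\alpha,\beta$ are permutations of $Q$ with $\alpha(0)=\beta(0)=0$ (for each $0\in Q$ such a decomposition exists and is unique). Groups are written additively even when not commutative; $\iota$ is the identity map, and for a map $f$, $-f$ denotes $x\mapsto-(f(x))$; powers of maps are with respect to composition. *)

theory Defs
  imports "HOL-Algebra.Sym_Groups"
begin

text \<open>
  A groupoid on a set Q is a function op of two arguments that maps Q into itself; only its
  values on Q matter. A group structure on Q is a HOL-Algebra group G with carrier Q. The paper
  writes groups additively, so x + y, 0 and -x there are the product, the unit and the
  inverse of G here. Commutativity of G is never assumed.
\<close>

definition quasigroup :: "'a set \<Rightarrow> ('a \<Rightarrow> 'a \<Rightarrow> 'a) \<Rightarrow> bool" where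
  "quasigroup Q op \<longleftrightarrow>
     (\<forall>x\<in>Q. \<forall>y\<in>Q. op x y \<in> Q) \<and>
     (\<forall>a\<in>Q. \<forall>b\<in>Q. \<exists>!x. x \<in> Q \<and> op x a = b) \<and>
     (\<forall>a\<in>Q. \<forall>b\<in>Q. \<exists>!y. y \<in> Q \<and> op a y = b)"

abbreviation maps_equal :: "'a set \<Rightarrow> ('a \<Rightarrow> 'b) \<Rightarrow> ('a \<Rightarrow> 'b) \<Rightarrow> bool" where
  "maps_equal Q f g \<equiv> (\<forall>x\<in>Q. f x = g x)"

subsection \<open>Parastrophes and the symmetry group\<close>

text \<open>
  The value at (u, v) of the parastrophe is the entry with index \<open>\<sigma> 3\<close> of the triple
  (x 1, x 2, x 3) in the graph of op whose entries with indices \<open>\<sigma> 1\<close> and \<open>\<sigma> 2\<close> are u and v.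
  Permutations act on indices from the right in the paper.
\<close>

definition parastrophe ::
    "'a set \<Rightarrow> ('a \<Rightarrow> 'a \<Rightarrow> 'a) \<Rightarrow> (nat \<Rightarrow> nat) \<Rightarrow> 'a \<Rightarrow> 'a \<Rightarrow> 'a" where
  "parastrophe Q op \<sigma> u v =
     (THE w. \<exists>x :: nat \<Rightarrow> 'a. (\<forall>i\<in>{1..3}. x i \<in> Q) \<and> op (x 1) (x 2) = x 3 \<and>
        x (\<sigma> 1) = u \<and> x (\<sigma> 2) = v \<and> x (\<sigma> 3) = w)"

definition Sym :: "'a set \<Rightarrow> ('a \<Rightarrow> 'a \<Rightarrow> 'a) \<Rightarrow> (nat \<Rightarrow> nat) set" where
  "Sym Q op =
     {\<sigma> \<in> carrier (sym_group 3). \<forall>u\<in>Q. \<forall>v\<in>Q. parastrophe Q op \<sigma> u v = op u v}"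

abbreviation perm_s :: "nat \<Rightarrow> nat" where "perm_s \<equiv> Transposition.transpose 1 2"
abbreviation perm_l :: "nat \<Rightarrow> nat" where "perm_l \<equiv> Transposition.transpose 1 3"
abbreviation perm_r :: "nat \<Rightarrow> nat" where "perm_r \<equiv> Transposition.transpose 2 3"

definition commutative :: "'a set \<Rightarrow> ('a \<Rightarrow> 'a \<Rightarrow> 'a) \<Rightarrow> bool" where
  "commutative Q op \<longleftrightarrow> perm_s \<in> Sym Q op"

definition left_symmetric :: "'a set \<Rightarrow> ('a \<Rightarrow> 'a \<Rightarrow> 'a) \<Rightarrow> bool" where
  "left_symmetric Q op \<longleftrightarrow> perm_r \<in> Sym Q op"

definition right_symmetric :: "'a set \<Rightarrow> ('a \<Rightarrow> 'a \<Rightarrow> 'a) \<Rightarrow> bool" where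
  "right_symmetric Q op \<longleftrightarrow> perm_l \<in> Sym Q op"

definition semi_symmetric :: "'a set \<Rightarrow> ('a \<Rightarrow> 'a \<Rightarrow> 'a) \<Rightarrow> bool" where
  "semi_symmetric Q op \<longleftrightarrow> carrier (alt_group 3) \<subseteq> Sym Q op"

definition totally_symmetric :: "'a set \<Rightarrow> ('a \<Rightarrow> 'a \<Rightarrow> 'a) \<Rightarrow> bool" where
  "totally_symmetric Q op \<longleftrightarrow> Sym Q op = carrier (sym_group 3)"

definition asymmetric :: "'a set \<Rightarrow> ('a \<Rightarrow> 'a \<Rightarrow> 'a) \<Rightarrow> bool" where
  "asymmetric Q op \<longleftrightarrow> Sym Q op = {id}"

definition strictly ::
    "('a set \<Rightarrow> ('a \<Rightarrow> 'a \<Rightarrow> 'a) \<Rightarrow> bool) \<Rightarrow> 'a set \<Rightarrow> ('a \<Rightarrow> 'a \<Rightarrow> 'a) \<Rightarrow> bool" where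
  "strictly P Q op \<longleftrightarrow> P Q op \<and> \<not> totally_symmetric Q op"

definition symmetry_classes :: "('a set \<Rightarrow> ('a \<Rightarrow> 'a \<Rightarrow> 'a) \<Rightarrow> bool) list" where
  "symmetry_classes =
     [strictly commutative, strictly left_symmetric, strictly right_symmetric,
      strictly semi_symmetric, totally_symmetric, asymmetric]"

subsection \<open>Group isotopes\<close>

definition isotope_of_group :: "'a monoid \<Rightarrow> ('a \<Rightarrow> 'a \<Rightarrow> 'a) \<Rightarrow> bool" where
  "isotope_of_group G op \<longleftrightarrow> group G \<and>
     (\<exists>\<alpha> \<beta> \<gamma>. bij_betw \<alpha> (carrier G) (carrier G) \<and> bij_betw \<beta> (carrier G) (carrier G) \<and>
        bij_betw \<gamma> (carrier G) (carrier G) \<and>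
        (\<forall>x\<in>carrier G. \<forall>y\<in>carrier G.
           op x y = inv_into (carrier G) \<gamma> (\<alpha> x \<otimes>\<^bsub>G\<^esub> \<beta> y)))"

definition group_isotope :: "'a set \<Rightarrow> ('a \<Rightarrow> 'a \<Rightarrow> 'a) \<Rightarrow> bool" where
  "group_isotope Q op \<longleftrightarrow> (\<exists>G. carrier G = Q \<and> isotope_of_group G op)"

text \<open>The extensional function space represents each binary operation on the carrier once.\<close>

definition isotopes :: "'a monoid \<Rightarrow> ('a \<Rightarrow> 'a \<Rightarrow> 'a) set" where
  "isotopes G =
     {op \<in> carrier G \<rightarrow>\<^sub>E (carrier G \<rightarrow>\<^sub>E carrier G). isotope_of_group G op}"

definition canonical_decomposition ::
    "'a set \<Rightarrow> ('a \<Rightarrow> 'a \<Rightarrow> 'a) \<Rightarrow> 'a \<Rightarrow> 'a monoid \<Rightarrow> ('a \<Rightarrow> 'a) \<Rightarrow> 'a \<Rightarrow> ('a \<Rightarrow> 'a) \<Rightarrow> bool" where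
  "canonical_decomposition Q op z G \<alpha> a \<beta> \<longleftrightarrow>
     group G \<and> carrier G = Q \<and> \<one>\<^bsub>G\<^esub> = z \<and> a \<in> Q \<and>
     bij_betw \<alpha> Q Q \<and> bij_betw \<beta> Q Q \<and> \<alpha> z = z \<and> \<beta> z = z \<and>
     (\<forall>x\<in>Q. \<forall>y\<in>Q. op x y = \<alpha> x \<otimes>\<^bsub>G\<^esub> a \<otimes>\<^bsub>G\<^esub> \<beta> y)"

definition anti_automorphism :: "'a monoid \<Rightarrow> ('a \<Rightarrow> 'a) \<Rightarrow> bool" where
  "anti_automorphism G f \<longleftrightarrow> bij_betw f (carrier G) (carrier G) \<and>
     (\<forall>x\<in>carrier G. \<forall>y\<in>carrier G. f (x \<otimes>\<^bsub>G\<^esub> y) = f y \<otimes>\<^bsub>G\<^esub> f x)"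

definition inner_map :: "'a monoid \<Rightarrow> 'a \<Rightarrow> 'a \<Rightarrow> 'a" where
  "inner_map G a x = inv\<^bsub>G\<^esub> a \<otimes>\<^bsub>G\<^esub> x \<otimes>\<^bsub>G\<^esub> a"

text \<open>On a quasigroup the parastrophe satisfies the equivalence by which it is usually defined.\<close>

lemma parastrophe_iff:
  assumes Q: "quasigroup Q op" and \<sigma>: "\<sigma> \<in> carrier (sym_group 3)"
    and x: "\<forall>i\<in>{1..3}. x i \<in> Q"
  shows "parastrophe Q op \<sigma> (x (\<sigma> 1)) (x (\<sigma> 2)) = x (\<sigma> 3) \<longleftrightarrow> op (x 1) (x 2) = x 3"
proof -
  have closed: "op u v \<in> Q" if "u \<in> Q" "v \<in> Q" for u v
    using Q that by (simp add: quasigroup_def)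
  have solL: "\<exists>!u. u \<in> Q \<and> op u v = w" and solR: "\<exists>!u. u \<in> Q \<and> op v u = w"
    if "v \<in> Q" "w \<in> Q" for v w
    using Q that by (simp_all add: quasigroup_def)
  have unL: "u = u'" if "op u v = op u' v" "u \<in> Q" "u' \<in> Q" "v \<in> Q" for u u' v
    using solL[of v "op u v"] closed[of u v] that by auto
  have unR: "u = u'" if "op v u = op v u'" "u \<in> Q" "u' \<in> Q" "v \<in> Q" for u u' v
    using solR[of v "op v u"] closed[of v u] that by auto
  have perm: "\<sigma> permutes {1..3}" using \<sigma> by (simp add: sym_group_carrier)
  have I: "{1..3::nat} = {1, 2, 3}" by auto
  have im: "\<sigma> 1 \<in> {1, 2, 3}" "\<sigma> 2 \<in> {1, 2, 3}" "\<sigma> 3 \<in> {1, 2, 3}"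
    using permutes_in_image[OF perm] unfolding I by blast+
  have ne: "\<sigma> 1 \<noteq> \<sigma> 2" "\<sigma> 1 \<noteq> \<sigma> 3" "\<sigma> 2 \<noteq> \<sigma> 3"
    using permutes_inj[OF perm] by (simp_all add: inj_eq)
  have cases6: "(\<sigma> 1 = 1 \<and> \<sigma> 2 = 2 \<and> \<sigma> 3 = 3) \<or> (\<sigma> 1 = 2 \<and> \<sigma> 2 = 1 \<and> \<sigma> 3 = 3) \<or>
      (\<sigma> 1 = 1 \<and> \<sigma> 2 = 3 \<and> \<sigma> 3 = 2) \<or> (\<sigma> 1 = 3 \<and> \<sigma> 2 = 1 \<and> \<sigma> 3 = 2) \<or>
      (\<sigma> 1 = 2 \<and> \<sigma> 2 = 3 \<and> \<sigma> 3 = 1) \<or> (\<sigma> 1 = 3 \<and> \<sigma> 2 = 2 \<and> \<sigma> 3 = 1)"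
    using im ne by (elim insertE emptyE) simp_all
  define T where "T y \<longleftrightarrow> (\<forall>i\<in>{1..3}. y i \<in> Q) \<and> op (y 1) (y 2) = y 3" for y :: "nat \<Rightarrow> 'a"
  have T: "T y \<longleftrightarrow> y 1 \<in> Q \<and> y 2 \<in> Q \<and> y 3 \<in> Q \<and> op (y 1) (y 2) = y 3" for y
    unfolding T_def I by auto
  have uniq: "y (\<sigma> 3) = y' (\<sigma> 3)"
    if h: "T y" "T y'" "y (\<sigma> 1) = y' (\<sigma> 1)" "y (\<sigma> 2) = y' (\<sigma> 2)" for y y'
  proof -
    consider "\<sigma> 3 = 3" "y 1 = y' 1" "y 2 = y' 2" | "\<sigma> 3 = 2" "y 1 = y' 1" "y 3 = y' 3"
      | "\<sigma> 3 = 1" "y 2 = y' 2" "y 3 = y' 3"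
      using cases6 h(3,4) by metis
    then show ?thesis
    proof cases
      case 1 with h(1,2) show ?thesis by (simp add: T)
    next
      case 2
      have "y 2 = y' 2" using unR[of "y 1" "y 2" "y' 2"] h(1,2) 2 unfolding T by metis
      with 2 show ?thesis by simp
    next
      case 3
      have "y 1 = y' 1" using unL[of "y 1" "y 2" "y' 1"] h(1,2) 3 unfolding T by metis
      with 3 show ?thesis by simp
    qed
  qed
  have "\<exists>y. T y \<and> y (\<sigma> 1) = x (\<sigma> 1) \<and> y (\<sigma> 2) = x (\<sigma> 2)"
  proof -
    have xQ: "x 1 \<in> Q" "x 2 \<in> Q" "x 3 \<in> Q" using x unfolding I by auto
    consider "\<sigma> 3 = 3" "\<sigma> 1 \<noteq> 3" "\<sigma> 2 \<noteq> 3" | "\<sigma> 3 = 2" "\<sigma> 1 \<noteq> 2" "\<sigma> 2 \<noteq> 2"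
      | "\<sigma> 3 = 1" "\<sigma> 1 \<noteq> 1" "\<sigma> 2 \<noteq> 1"
      using cases6 ne by metis
    then show ?thesis
    proof cases
      case 1
      then show ?thesis
        using xQ closed by (intro exI[of _ "x(3 := op (x 1) (x 2))"]) (simp add: T)
    next
      case 2
      obtain u where "u \<in> Q" "op (x 1) u = x 3" using solR xQ by blast
      with 2 xQ show ?thesis by (intro exI[of _ "x(2 := u)"]) (simp add: T)
    next
      case 3
      obtain u where "u \<in> Q" "op u (x 2) = x 3" using solL xQ by blast
      with 3 xQ show ?thesis by (intro exI[of _ "x(1 := u)"]) (simp add: T)
    qed
  qed
  then obtain y where y: "T y" "y (\<sigma> 1) = x (\<sigma> 1)" "y (\<sigma> 2) = x (\<sigma> 2)" by blast
  have "parastrophe Q op \<sigma> (x (\<sigma> 1)) (x (\<sigma> 2)) = y (\<sigma> 3)"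
    unfolding parastrophe_def
  proof (rule the_equality)
    show "\<exists>t. (\<forall>i\<in>{1..3}. t i \<in> Q) \<and> op (t 1) (t 2) = t 3 \<and>
        t (\<sigma> 1) = x (\<sigma> 1) \<and> t (\<sigma> 2) = x (\<sigma> 2) \<and> t (\<sigma> 3) = y (\<sigma> 3)"
      using y unfolding T_def by blast
  next
    fix w
    assume "\<exists>t. (\<forall>i\<in>{1..3}. t i \<in> Q) \<and> op (t 1) (t 2) = t 3 \<and>
        t (\<sigma> 1) = x (\<sigma> 1) \<and> t (\<sigma> 2) = x (\<sigma> 2) \<and> t (\<sigma> 3) = w"
    then obtain t where "T t" "t (\<sigma> 1) = x (\<sigma> 1)" "t (\<sigma> 2) = x (\<sigma> 2)" "t (\<sigma> 3) = w"
      unfolding T_def by blast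
    with uniq[of t y] y show "w = y (\<sigma> 3)" by simp
  qed
  moreover have "op (x 1) (x 2) = x 3 \<longleftrightarrow> T x" using x by (simp add: T_def)
  moreover have "T x" if "y (\<sigma> 3) = x (\<sigma> 3)"
  proof -
    have "y 1 = x 1 \<and> y 2 = x 2 \<and> y 3 = x 3" using cases6 y(2,3) that by metis
    with y(1) show ?thesis by (simp add: T)
  qed
  moreover have "y (\<sigma> 3) = x (\<sigma> 3)" if "T x" using uniq[OF y(1) that y(2,3)] .
  ultimately show ?thesis by auto
qed

end

(* The symmetries of a quasigroup form a subgroup of S_3, so they are known once the membership of
   s, r, l and one 3-cycle is. Each membership is an identity in two variables. Substituting 0 into
   it expresses one of the two maps alpha, beta through the other and through a. Put back into the
   identity, this makes + commutative for s, r and l: in the last two cases a conjugate of -iota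
   turns out to be a homomorphism. For the 3-cycle it makes beta an anti-automorphism. *)
theory Submission
  imports Defs
begin

text \<open>Since \<alpha> and \<beta> are onto, \<alpha> x + a and a + \<beta> y range freely over
  the group, so an inner product can be written z + w with z and w free. The right-hand side of each
  nested identity is a bare variable; comparing with the instance where the other variable is 0
  removes it, and no inverse of \<alpha> or \<beta> enters. The order of the summands then decides
  the outcome. For r the repeated variable is the left factor both times, u + a + \<beta>(u + z) = a
  + \<beta> z, and \<beta> preserves sums; l is the mirror image. But \<beta> u = -a - u + a also
  reverses sums, as every conjugate of -\<iota> does, and doing both forces commutativity. For the
  3-cycle the repeated variable is a left factor outside and a right factor inside, so the order is
  reversed and nothing forces commutativity. The clause on the cube of \<alpha> is the relation
  \<alpha> y + a + \<beta>(\<beta> y) = a read at y = \<alpha>(\<alpha> x), once \<beta> inverts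
  \<alpha>.\<close>

section \<open>The elements of S_3 and of A_3\<close>

lemma perm_s_r_s: "perm_s \<circ> perm_r \<circ> perm_s = perm_l"
  by (auto simp: fun_eq_iff transpose_def)

text \<open>A permutation of three points is determined by its values at 1 and 2. Passing to these
  pairs replaces inequality of functions by inequality of numerals, which simplification
  decides.\<close>

lemma perm_distinct:
  "distinct [id, perm_s, perm_l, perm_r, perm_s \<circ> perm_r, perm_r \<circ> perm_s]"
proof (rule distinct_map[THEN iffD1, THEN conjunct1])
  show "distinct (map (\<lambda>p. (p 1, p 2))
      [id, perm_s, perm_l, perm_r, perm_s \<circ> perm_r, perm_r \<circ> perm_s])"
    by (simp add: transpose_def)
qed

lemma sym_group_3_carrier:
  "carrier (sym_group 3) = {id, perm_s, perm_l, perm_r, perm_s \<circ> perm_r, perm_r \<circ> perm_s}"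
    (is "_ = ?S")
proof (intro equalityI subsetI)
  fix p :: "nat \<Rightarrow> nat"
  assume "p \<in> carrier (sym_group 3)"
  then have p: "p permutes {1..3}" by (simp add: sym_group_carrier)
  have I: "{1..3::nat} = {1, 2, 3}" by auto
  have im: "p 1 \<in> {1, 2, 3}" "p 2 \<in> {1, 2, 3}" "p 3 \<in> {1, 2, 3}"
    using permutes_in_image[OF p] unfolding I by blast+
  have ne: "p 1 \<noteq> p 2" "p 1 \<noteq> p 3" "p 2 \<noteq> p 3"
    using permutes_inj[OF p] by (simp_all add: inj_eq)
  have eqI: "p = q" if "p 1 = q 1" "p 2 = q 2" "p 3 = q 3" "q permutes {1..3}" for q
  proof
    fix i :: nat
    have "i = 1 \<or> i = 2 \<or> i = 3 \<or> i \<notin> {1..3}" unfolding I by blast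
    then show "p i = q i"
      using that(1-3) permutes_not_in[OF p, of i] permutes_not_in[OF that(4), of i] by metis
  qed
  have gen: "perm_s permutes {1..3}" "perm_l permutes {1..3}" "perm_r permutes {1..3}"
    by (rule permutes_swap_id; simp)+
  note perms = permutes_id gen permutes_compose[OF gen(3) gen(1)] permutes_compose[OF gen(1) gen(3)]
  have "(p 1 = 1 \<and> p 2 = 2 \<and> p 3 = 3) \<or> (p 1 = 2 \<and> p 2 = 1 \<and> p 3 = 3) \<or>
      (p 1 = 3 \<and> p 2 = 2 \<and> p 3 = 1) \<or> (p 1 = 1 \<and> p 2 = 3 \<and> p 3 = 2) \<or>
      (p 1 = 2 \<and> p 2 = 3 \<and> p 3 = 1) \<or> (p 1 = 3 \<and> p 2 = 1 \<and> p 3 = 2)"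
    using im ne by (elim insertE emptyE) simp_all
  then have "p = id \<or> p = perm_s \<or> p = perm_l \<or> p = perm_r \<or> p = perm_s \<circ> perm_r \<or>
      p = perm_r \<circ> perm_s"
  proof (elim disjE conjE)
    assume "p 1 = 1" "p 2 = 2" "p 3 = 3"
    then have "p = id" by (intro eqI perms) (simp_all add: transpose_def)
    then show ?thesis by blast
  next
    assume "p 1 = 2" "p 2 = 1" "p 3 = 3"
    then have "p = perm_s" by (intro eqI perms) (simp_all add: transpose_def)
    then show ?thesis by blast
  next
    assume "p 1 = 3" "p 2 = 2" "p 3 = 1"
    then have "p = perm_l" by (intro eqI perms) (simp_all add: transpose_def)
    then show ?thesis by blast
  next
    assume "p 1 = 1" "p 2 = 3" "p 3 = 2"
    then have "p = perm_r" by (intro eqI perms) (simp_all add: transpose_def)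
    then show ?thesis by blast
  next
    assume "p 1 = 2" "p 2 = 3" "p 3 = 1"
    then have "p = perm_s \<circ> perm_r" by (intro eqI perms) (simp_all add: transpose_def)
    then show ?thesis by blast
  next
    assume "p 1 = 3" "p 2 = 1" "p 3 = 2"
    then have "p = perm_r \<circ> perm_s" by (intro eqI perms) (simp_all add: transpose_def)
    then show ?thesis by blast
  qed
  then show "p \<in> ?S" by blast
next
  fix p :: "nat \<Rightarrow> nat"
  have gen: "perm_s permutes {1..3}" "perm_l permutes {1..3}" "perm_r permutes {1..3}"
    by (rule permutes_swap_id; simp)+
  assume "p \<in> ?S"
  then show "p \<in> carrier (sym_group 3)"
    using gen permutes_id permutes_compose[OF gen(3) gen(1)] permutes_compose[OF gen(1) gen(3)]
    by (auto simp: sym_group_carrier)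
qed

lemma alt_group_3_carrier:
  "carrier (alt_group 3) = {id, perm_s \<circ> perm_r, perm_r \<circ> perm_s}"
proof -
  have "carrier (alt_group 3) = {p \<in> carrier (sym_group 3). evenperm p}"
    by (auto simp: alt_group_carrier sym_group_carrier)
  also have "\<dots> = {id, perm_s \<circ> perm_r, perm_r \<circ> perm_s}"
    unfolding sym_group_3_carrier
    by (auto simp: evenperm_id evenperm_swap evenperm_comp permutation_swap_id)
  finally show ?thesis .
qed

section \<open>Symmetry groups as subgroups of S_3\<close>

text \<open>Removes the description operator: a symmetry is a permutation of indices that preserves
  the graph of \<open>op\<close>, and in this form symmetries can be composed.\<close>

lemma Sym_iff:
  fixes op :: "'a \<Rightarrow> 'a \<Rightarrow> 'a"
  assumes Q: "quasigroup Q op"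
  shows "\<sigma> \<in> Sym Q op \<longleftrightarrow> \<sigma> \<in> carrier (sym_group 3) \<and>
    (\<forall>x :: nat \<Rightarrow> 'a. (\<forall>i\<in>{1..3}. x i \<in> Q) \<longrightarrow>
      (op (x 1) (x 2) = x 3 \<longleftrightarrow> op (x (\<sigma> 1)) (x (\<sigma> 2)) = x (\<sigma> 3)))"
    (is "_ \<longleftrightarrow> _ \<and> ?R")
proof (cases "\<sigma> \<in> carrier (sym_group 3)")
  case True
  then have p: "\<sigma> permutes {1..3}" by (simp add: sym_group_carrier)
  have closed: "op u v \<in> Q" if "u \<in> Q" "v \<in> Q" for u v
    using Q that by (simp add: quasigroup_def)
  have range: "\<sigma> 1 \<in> {1..3}" "\<sigma> 2 \<in> {1..3}"
    using permutes_in_image[OF p] by auto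
  have "(\<forall>u\<in>Q. \<forall>v\<in>Q. parastrophe Q op \<sigma> u v = op u v) \<longleftrightarrow> ?R"
    (is "?L \<longleftrightarrow> _")
  proof
    assume ?L
    then show ?R using parastrophe_iff[OF Q True] range by metis
  next
    assume R: ?R
    show ?L
    proof (intro ballI)
      fix u v
      assume uv: "u \<in> Q" "v \<in> Q"
      \<comment> \<open>Reindexing by the inverse of \<sigma> places u, v and \<open>op u v\<close>
        at the positions \<sigma> 1, \<sigma> 2 and \<sigma> 3, where the criterion reads
        them.\<close>
      define x where "x = (\<lambda>i. if i = 1 then u else if i = 2 then v else op u v) \<circ> inv_into UNIV \<sigma>"
      have x: "\<forall>i\<in>{1..3}. x i \<in> Q" using uv closed by (simp add: x_def)
      have \<sigma>: "x (\<sigma> 1) = u" "x (\<sigma> 2) = v" "x (\<sigma> 3) = op u v"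
        using permutes_inverses(2)[OF p] by (simp_all add: x_def)
      then show "parastrophe Q op \<sigma> u v = op u v"
        using R x parastrophe_iff[OF Q True x] by metis
    qed
  qed
  with True show ?thesis by (simp add: Sym_def)
qed (simp add: Sym_def)

lemma id_in_Sym: "quasigroup Q op \<Longrightarrow> id \<in> Sym Q op"
  by (simp add: Sym_iff sym_group_3_carrier)

lemma Sym_comp:
  fixes op :: "'a \<Rightarrow> 'a \<Rightarrow> 'a"
  assumes Q: "quasigroup Q op" and \<sigma>: "\<sigma> \<in> Sym Q op" and \<tau>: "\<tau> \<in> Sym Q op"
  shows "\<sigma> \<circ> \<tau> \<in> Sym Q op"
proof -
  have p: "\<sigma> permutes {1..3}" "\<tau> permutes {1..3}"
    using \<sigma> \<tau> by (simp_all add: Sym_def sym_group_carrier)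
  have "op (x 1) (x 2) = x 3 \<longleftrightarrow>
      op (x ((\<sigma> \<circ> \<tau>) 1)) (x ((\<sigma> \<circ> \<tau>) 2)) = x ((\<sigma> \<circ> \<tau>) 3)"
    if x: "\<forall>i\<in>{1..3}. x i \<in> Q" for x :: "nat \<Rightarrow> 'a"
  proof -
    \<comment> \<open>The criterion for \<tau> is used on the reindexed triple
      \<open>x \<circ> \<sigma>\<close>, that for \<sigma> on x itself; this yields the composition
      in the stated order.\<close>
    have "\<forall>i\<in>{1..3}. (x \<circ> \<sigma>) i \<in> Q"
      using x permutes_in_image[OF p(1)] by (simp del: atLeastAtMost_iff)
    then have "op (x (\<sigma> 1)) (x (\<sigma> 2)) = x (\<sigma> 3) \<longleftrightarrow>
        op (x (\<sigma> (\<tau> 1))) (x (\<sigma> (\<tau> 2))) = x (\<sigma> (\<tau> 3))"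
      using \<tau>[unfolded Sym_iff[OF Q]] by (metis comp_apply)
    with x show ?thesis using \<sigma>[unfolded Sym_iff[OF Q]] by simp
  qed
  then show ?thesis
    using permutes_compose[OF p(2,1)] by (simp add: Sym_iff[OF Q] sym_group_carrier)
qed

lemma Sym_subset: "Sym Q op \<subseteq> {id, perm_s, perm_l, perm_r, perm_s \<circ> perm_r, perm_r \<circ> perm_s}"
  using sym_group_3_carrier by (auto simp: Sym_def)

text \<open>Each 3-cycle is the square of the other, so closure under composition carries membership
  both ways and one 3-cycle is enough to test.\<close>

lemma Sym_rotation_iff:
  assumes "quasigroup Q op"
  shows "perm_r \<circ> perm_s \<in> Sym Q op \<longleftrightarrow> perm_s \<circ> perm_r \<in> Sym Q op"
proof -
  have "(perm_s \<circ> perm_r) \<circ> (perm_s \<circ> perm_r) = perm_r \<circ> perm_s"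
    "(perm_r \<circ> perm_s) \<circ> (perm_r \<circ> perm_s) = perm_s \<circ> perm_r"
    by (auto simp: fun_eq_iff transpose_def)
  then show ?thesis using Sym_comp[OF assms] by metis
qed

text \<open>The transpositions s and r generate S_3: their two products are the 3-cycles, and the
  third transposition is the conjugate \<open>perm_s_r_s\<close>.\<close>

lemma totally_symmetric_iff:
  assumes Q: "quasigroup Q op"
  shows "totally_symmetric Q op \<longleftrightarrow> perm_s \<in> Sym Q op \<and> perm_r \<in> Sym Q op"
proof
  assume "perm_s \<in> Sym Q op \<and> perm_r \<in> Sym Q op"
  then have *: "perm_s \<in> Sym Q op" "perm_r \<in> Sym Q op" by simp_all
  note c = Sym_comp[OF Q]
  show "totally_symmetric Q op"
    using * c[OF *] c[OF *(2,1)] c[OF c[OF *] *(1)] id_in_Sym[OF Q] Sym_subset[of Q op]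
    unfolding perm_s_r_s totally_symmetric_def sym_group_3_carrier by blast
qed (simp add: totally_symmetric_def sym_group_3_carrier)

text \<open>Four tests rule out all five nontrivial permutations, since the second 3-cycle follows
  the first by \<open>Sym_rotation_iff\<close>.\<close>

lemma asymmetric_iff:
  assumes Q: "quasigroup Q op"
  shows "asymmetric Q op \<longleftrightarrow> perm_s \<notin> Sym Q op \<and> perm_r \<notin> Sym Q op \<and> perm_l \<notin> Sym Q op \<and>
    perm_s \<circ> perm_r \<notin> Sym Q op"
proof
  assume "asymmetric Q op"
  then show "perm_s \<notin> Sym Q op \<and> perm_r \<notin> Sym Q op \<and> perm_l \<notin> Sym Q op \<and>
      perm_s \<circ> perm_r \<notin> Sym Q op"
    using perm_distinct unfolding asymmetric_def
    by (simp only: distinct.simps list.set insert_iff empty_iff simp_thms de_Morgan_disj) metis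
next
  assume "perm_s \<notin> Sym Q op \<and> perm_r \<notin> Sym Q op \<and> perm_l \<notin> Sym Q op \<and>
    perm_s \<circ> perm_r \<notin> Sym Q op"
  then show "asymmetric Q op"
    using Sym_subset[of Q op] id_in_Sym[OF Q] Sym_rotation_iff[OF Q]
    unfolding asymmetric_def by blast
qed

lemma semi_symmetric_iff:
  assumes Q: "quasigroup Q op"
  shows "semi_symmetric Q op \<longleftrightarrow> perm_s \<circ> perm_r \<in> Sym Q op"
  using id_in_Sym[OF Q] Sym_rotation_iff[OF Q]
  unfolding semi_symmetric_def alt_group_3_carrier by blast

section \<open>The six possible symmetry groups and the six classes\<close>

text \<open>Two transpositions, or a transposition and a 3-cycle, already generate S_3. Hence at
  most one of the memberships of s, r, l and the 3-cycle holds unless all of them do, and these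
  memberships determine the group.\<close>

lemma Sym_cases:
  assumes Q: "quasigroup Q op"
  obtains
    "Sym Q op = {id}" | "Sym Q op = {id, perm_s}" | "Sym Q op = {id, perm_r}"
  | "Sym Q op = {id, perm_l}" | "Sym Q op = carrier (alt_group 3)"
  | "Sym Q op = carrier (sym_group 3)"
proof -
  note c = Sym_comp[OF Q]
  \<comment> \<open>Every generating pair is brought back to the pair s, r; the words in
    \<open>e\<close> express the missing members of that pair.\<close>
  have two: "perm_s \<in> Sym Q op \<and> perm_r \<in> Sym Q op"
    if "perm_s \<in> Sym Q op \<and> perm_r \<in> Sym Q op \<or> perm_s \<in> Sym Q op \<and> perm_l \<in> Sym Q op \<or>
      perm_r \<in> Sym Q op \<and> perm_l \<in> Sym Q op \<or>
      perm_s \<circ> perm_r \<in> Sym Q op \<and>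
        (perm_s \<in> Sym Q op \<or> perm_r \<in> Sym Q op \<or> perm_l \<in> Sym Q op)"
  proof -
    have e: "perm_s \<circ> perm_l \<circ> perm_s = perm_r" "perm_r \<circ> perm_l \<circ> perm_r = perm_s"
      "perm_s \<circ> (perm_s \<circ> perm_r) = perm_r" "(perm_s \<circ> perm_r) \<circ> perm_r = perm_s"
      "perm_l \<circ> (perm_s \<circ> perm_r) = perm_s" "(perm_s \<circ> perm_r) \<circ> perm_l = perm_r"
      by (auto simp: fun_eq_iff transpose_def)
    show ?thesis using that c e by metis
  qed
  have full: "Sym Q op = carrier (sym_group 3)" if "perm_s \<in> Sym Q op" "perm_r \<in> Sym Q op"
    using totally_symmetric_iff[OF Q] that by (simp add: totally_symmetric_def)
  note S = Sym_subset[of Q op] id_in_Sym[OF Q] Sym_rotation_iff[OF Q]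
  consider (all) "perm_s \<in> Sym Q op" "perm_r \<in> Sym Q op"
    | (rot) "perm_s \<circ> perm_r \<in> Sym Q op" "perm_s \<notin> Sym Q op" "perm_r \<notin> Sym Q op" "perm_l \<notin> Sym Q op"
    | (s) "perm_s \<circ> perm_r \<notin> Sym Q op" "perm_s \<in> Sym Q op" "perm_r \<notin> Sym Q op" "perm_l \<notin> Sym Q op"
    | (r) "perm_s \<circ> perm_r \<notin> Sym Q op" "perm_s \<notin> Sym Q op" "perm_r \<in> Sym Q op" "perm_l \<notin> Sym Q op"
    | (l) "perm_s \<circ> perm_r \<notin> Sym Q op" "perm_s \<notin> Sym Q op" "perm_r \<notin> Sym Q op" "perm_l \<in> Sym Q op"
    | (none) "perm_s \<circ> perm_r \<notin> Sym Q op" "perm_s \<notin> Sym Q op" "perm_r \<notin> Sym Q op" "perm_l \<notin> Sym Q op"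
    using two by argo
  then show thesis
  proof cases
    case all
    then show thesis by (intro that(6) full)
  next
    case rot
    then have "Sym Q op = carrier (alt_group 3)"
      using S unfolding alt_group_3_carrier by blast
    then show thesis by (rule that(5))
  next
    case s
    then have "Sym Q op = {id, perm_s}" using S by blast
    then show thesis by (rule that(2))
  next
    case r
    then have "Sym Q op = {id, perm_r}" using S by blast
    then show thesis by (rule that(3))
  next
    case l
    then have "Sym Q op = {id, perm_l}" using S by blast
    then show thesis by (rule that(4))
  next
    case none
    then have "Sym Q op = {id}" using S by blast
    then show thesis by (rule that(1))
  qed
qed

lemma distinct_symmetry_groups:
  "distinct [{id, perm_s}, {id, perm_r}, {id, perm_l}, carrier (alt_group 3),
    carrier (sym_group 3), {id}]"
proof -
  \<comment> \<open>With variables in place of the permutations, only their distinctness matters.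
    The memberships of s, r, l and c tell the six sets apart.\<close>
  have "distinct [{e, s}, {e, r}, {e, l}, {e, c, d}, {e, s, l, r, c, d}, {e}]"
    if "distinct [e, s, l, r, c, d]" for e s l r c d :: "nat \<Rightarrow> nat"
  proof (rule distinct_map[THEN iffD1, THEN conjunct1])
    show "distinct (map (\<lambda>S. (s \<in> S, r \<in> S, l \<in> S, c \<in> S))
        [{e, s}, {e, r}, {e, l}, {e, c, d}, {e, s, l, r, c, d}, {e}])"
      using that by auto
  qed
  from this[OF perm_distinct] show ?thesis
    unfolding alt_group_3_carrier sym_group_3_carrier .
qed

text \<open>Each transposition lies in exactly one proper subgroup of the list, and so does the
  3-cycle. Once the whole of S_3 is excluded, one membership therefore determines the group.\<close>

lemma strict_classes_iff:
  assumes Q: "quasigroup Q op"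
  shows "strictly commutative Q op \<longleftrightarrow> Sym Q op = {id, perm_s}"
    and "strictly left_symmetric Q op \<longleftrightarrow> Sym Q op = {id, perm_r}"
    and "strictly right_symmetric Q op \<longleftrightarrow> Sym Q op = {id, perm_l}"
    and "strictly semi_symmetric Q op \<longleftrightarrow> Sym Q op = carrier (alt_group 3)"
proof -
  let ?F = "carrier (sym_group 3)" and ?A = "carrier (alt_group 3)"
  have mem: "s \<notin> {e} \<and> s \<notin> {e, r} \<and> s \<notin> {e, l} \<and> s \<notin> {e, c, d} \<and>
      r \<notin> {e} \<and> r \<notin> {e, s} \<and> r \<notin> {e, l} \<and> r \<notin> {e, c, d} \<and>
      l \<notin> {e} \<and> l \<notin> {e, s} \<and> l \<notin> {e, r} \<and> l \<notin> {e, c, d} \<and>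
      c \<notin> {e} \<and> c \<notin> {e, s} \<and> c \<notin> {e, r} \<and> c \<notin> {e, l}"
    if "distinct [e, s, l, r, c, d]" for e s l r c d :: "nat \<Rightarrow> nat"
    using that by auto
  have ne: "S \<noteq> F \<and> R \<noteq> F \<and> L \<noteq> F \<and> A \<noteq> F"
    if "distinct [S, R, L, A, F, E]" for S R L A F E :: "(nat \<Rightarrow> nat) set"
    using that by simp
  \<comment> \<open>Pure set reasoning about six unspecified sets and four witnesses, which keeps
    the concrete permutations out of the search.\<close>
  have iffs: "(s \<in> X \<and> X \<noteq> F \<longleftrightarrow> X = S) \<and> (r \<in> X \<and> X \<noteq> F \<longleftrightarrow> X = R) \<and>
      (l \<in> X \<and> X \<noteq> F \<longleftrightarrow> X = L) \<and> (A \<subseteq> X \<and> X \<noteq> F \<longleftrightarrow> X = A)"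
    if "X = E \<or> X = S \<or> X = R \<or> X = L \<or> X = A \<or> X = F"
      and "s \<in> S" "r \<in> R" "l \<in> L" "c \<in> A"
      and "s \<notin> E \<and> s \<notin> R \<and> s \<notin> L \<and> s \<notin> A \<and> r \<notin> E \<and> r \<notin> S \<and> r \<notin> L \<and> r \<notin> A \<and>
        l \<notin> E \<and> l \<notin> S \<and> l \<notin> R \<and> l \<notin> A \<and> c \<notin> E \<and> c \<notin> S \<and> c \<notin> R \<and> c \<notin> L"
      and "S \<noteq> F \<and> R \<noteq> F \<and> L \<noteq> F \<and> A \<noteq> F"
    for X E S R L A F :: "(nat \<Rightarrow> nat) set" and s r l c
    using that by blast
  have "Sym Q op = {id} \<or> Sym Q op = {id, perm_s} \<or> Sym Q op = {id, perm_r} \<or>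
      Sym Q op = {id, perm_l} \<or> Sym Q op = ?A \<or> Sym Q op = ?F"
    by (rule Sym_cases[OF Q]) simp_all
  note * = iffs[OF this _ _ _ _ mem[OF perm_distinct, folded alt_group_3_carrier]
      ne[OF distinct_symmetry_groups]]
  have **: "(perm_s \<in> Sym Q op \<and> Sym Q op \<noteq> ?F \<longleftrightarrow> Sym Q op = {id, perm_s}) \<and>
      (perm_r \<in> Sym Q op \<and> Sym Q op \<noteq> ?F \<longleftrightarrow> Sym Q op = {id, perm_r}) \<and>
      (perm_l \<in> Sym Q op \<and> Sym Q op \<noteq> ?F \<longleftrightarrow> Sym Q op = {id, perm_l}) \<and>
      (?A \<subseteq> Sym Q op \<and> Sym Q op \<noteq> ?F \<longleftrightarrow> Sym Q op = ?A)"
    by (rule *) (simp_all only: alt_group_3_carrier insert_iff simp_thms)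
  show "strictly commutative Q op \<longleftrightarrow> Sym Q op = {id, perm_s}"
    unfolding strictly_def commutative_def totally_symmetric_def by (rule **[THEN conjunct1])
  show "strictly left_symmetric Q op \<longleftrightarrow> Sym Q op = {id, perm_r}"
    unfolding strictly_def left_symmetric_def totally_symmetric_def
    by (rule **[THEN conjunct2, THEN conjunct1])
  show "strictly right_symmetric Q op \<longleftrightarrow> Sym Q op = {id, perm_l}"
    unfolding strictly_def right_symmetric_def totally_symmetric_def
    by (rule **[THEN conjunct2, THEN conjunct2, THEN conjunct1])
  show "strictly semi_symmetric Q op \<longleftrightarrow> Sym Q op = ?A"
    unfolding strictly_def semi_symmetric_def totally_symmetric_def
    by (rule **[THEN conjunct2, THEN conjunct2, THEN conjunct2])
qed

lemma symmetry_classes_disjoint: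
  assumes Q: "quasigroup Q op" and ij: "i < 6" "j < 6"
    and i: "(symmetry_classes ! i) Q op" and j: "(symmetry_classes ! j) Q op"
  shows "i = j"
proof -
  \<comment> \<open>The order is that of \<open>symmetry_classes\<close>, so distinctness of this
    list turns equal symmetry groups into equal indices.\<close>
  let ?L = "[{id, perm_s}, {id, perm_r}, {id, perm_l}, carrier (alt_group 3),
    carrier (sym_group 3), {id}]"
  have L: "(symmetry_classes ! k) Q op \<longleftrightarrow> Sym Q op = ?L ! k" if "k < 6" for k
  proof -
    have "k = 0 \<or> k = 1 \<or> k = 2 \<or> k = 3 \<or> k = 4 \<or> k = 5" using that by linarith
    then show ?thesis
      using strict_classes_iff[OF Q]
      by (elim disjE) (simp_all add: symmetry_classes_def totally_symmetric_def asymmetric_def)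
  qed
  have "?L ! i = ?L ! j" using L ij i j by metis
  then show ?thesis using ij nth_eq_iff_index_eq[OF distinct_symmetry_groups, of i j] by auto
qed

lemma symmetry_classes_cover:
  assumes Q: "quasigroup Q op"
  shows "\<exists>i<6. (symmetry_classes ! i) Q op"
proof -
  have "\<exists>P\<in>set symmetry_classes. P Q op"
    by (rule Sym_cases[OF Q])
      (simp_all add: symmetry_classes_def strict_classes_iff[OF Q] totally_symmetric_def
        asymmetric_def)
  moreover have "length symmetry_classes = 6" by (simp add: symmetry_classes_def)
  ultimately show ?thesis by (metis in_set_conv_nth)
qed

section \<open>Symmetries as identities in two variables\<close>

text \<open>The third entry of a triple in the graph is a function of the first two; substituting it
  turns one implication of the graph criterion into an identity. For a transposition, the same
  implication on the permuted triple is the converse.\<close>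

lemma
  fixes op :: "'a \<Rightarrow> 'a \<Rightarrow> 'a"
  assumes Q: "quasigroup Q op"
  shows commutative_iff: "perm_s \<in> Sym Q op \<longleftrightarrow> (\<forall>x\<in>Q. \<forall>y\<in>Q. op y x = op x y)"
    and left_symmetric_iff: "perm_r \<in> Sym Q op \<longleftrightarrow> (\<forall>x\<in>Q. \<forall>y\<in>Q. op x (op x y) = y)"
    and right_symmetric_iff: "perm_l \<in> Sym Q op \<longleftrightarrow> (\<forall>x\<in>Q. \<forall>y\<in>Q. op (op x y) y = x)"
    and rotation_iff: "perm_s \<circ> perm_r \<in> Sym Q op \<longleftrightarrow> (\<forall>x\<in>Q. \<forall>y\<in>Q. op y (op x y) = x)"
proof -
  have closed: "op u v \<in> Q" if "u \<in> Q" "v \<in> Q" for u v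
    using Q that by (simp add: quasigroup_def)
  have I: "{1..3::nat} = {1, 2, 3}" by auto
  \<comment> \<open>Only the values at 1, 2 and 3 of an index function matter, so any three elements
    of Q are realised by one.\<close>
  have triple: "(\<forall>x :: nat \<Rightarrow> 'a. (\<forall>i\<in>{1..3}. x i \<in> Q) \<longrightarrow> P (x 1) (x 2) (x 3)) \<longleftrightarrow>
      (\<forall>u\<in>Q. \<forall>v\<in>Q. \<forall>w\<in>Q. P u v w)" (is "?L \<longleftrightarrow> ?R") for P
  proof
    assume L: ?L
    show ?R
    proof (intro ballI)
      fix u v w assume "u \<in> Q" "v \<in> Q" "w \<in> Q"
      then show "P u v w"
        using L[rule_format, of "\<lambda>i. if i = 1 then u else if i = 2 then v else w"] by auto
    qed
  qed (simp add: I)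
  have inS: "perm_s \<in> carrier (sym_group 3)" "perm_r \<in> carrier (sym_group 3)"
    "perm_l \<in> carrier (sym_group 3)" "perm_s \<circ> perm_r \<in> carrier (sym_group 3)"
    by (simp_all add: sym_group_3_carrier)
  have "perm_s \<in> Sym Q op \<longleftrightarrow> (\<forall>u\<in>Q. \<forall>v\<in>Q. \<forall>w\<in>Q. op u v = w \<longleftrightarrow> op v u = w)"
    unfolding Sym_iff[OF Q] triple[symmetric] using inS by (simp add: transpose_def)
  then show "perm_s \<in> Sym Q op \<longleftrightarrow> (\<forall>x\<in>Q. \<forall>y\<in>Q. op y x = op x y)"
    using closed by metis
  have "perm_r \<in> Sym Q op \<longleftrightarrow> (\<forall>u\<in>Q. \<forall>v\<in>Q. \<forall>w\<in>Q. op u v = w \<longleftrightarrow> op u w = v)"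
    unfolding Sym_iff[OF Q] triple[symmetric] using inS by (simp add: transpose_def)
  then show "perm_r \<in> Sym Q op \<longleftrightarrow> (\<forall>x\<in>Q. \<forall>y\<in>Q. op x (op x y) = y)"
    using closed by metis
  have "perm_l \<in> Sym Q op \<longleftrightarrow> (\<forall>u\<in>Q. \<forall>v\<in>Q. \<forall>w\<in>Q. op u v = w \<longleftrightarrow> op w v = u)"
    unfolding Sym_iff[OF Q] triple[symmetric] using inS by (simp add: transpose_def)
  then show "perm_l \<in> Sym Q op \<longleftrightarrow> (\<forall>x\<in>Q. \<forall>y\<in>Q. op (op x y) y = x)"
    using closed by metis
  have "perm_s \<circ> perm_r \<in> Sym Q op \<longleftrightarrow> (\<forall>u\<in>Q. \<forall>v\<in>Q. \<forall>w\<in>Q. op u v = w \<longleftrightarrow> op v w = u)"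
    unfolding Sym_iff[OF Q] triple[symmetric] using inS by (simp add: transpose_def)
  then show "perm_s \<circ> perm_r \<in> Sym Q op \<longleftrightarrow> (\<forall>x\<in>Q. \<forall>y\<in>Q. op y (op x y) = x)"
    using closed
    \<comment> \<open>Inverting \<open>(u, v, w) \<mapsto> (v, w, u)\<close> uses that it has order three.\<close>
    by metis
qed

section \<open>Isotopes of groups are quasigroups\<close>

text \<open>Applying \<gamma> turns an equation for \<open>op\<close> into one in the group. The
  known summand moves to the other side, and bijectivity of \<alpha> or \<beta> gives the unique
  solution.\<close>

lemma isotope_of_group_quasigroup:
  assumes "isotope_of_group G op"
  shows "quasigroup (carrier G) op"
proof -
  let ?Q = "carrier G"
  obtain \<alpha> \<beta> \<gamma> where G: "group G"
    and bij: "bij_betw \<alpha> ?Q ?Q" "bij_betw \<beta> ?Q ?Q" "bij_betw \<gamma> ?Q ?Q"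
    and op: "\<And>x y. x \<in> ?Q \<Longrightarrow> y \<in> ?Q \<Longrightarrow> op x y = inv_into ?Q \<gamma> (\<alpha> x \<otimes>\<^bsub>G\<^esub> \<beta> y)"
    using assms unfolding isotope_of_group_def by blast
  interpret group G by (rule G)
  have mem: "\<alpha> x \<in> ?Q" "\<beta> x \<in> ?Q" "\<gamma> x \<in> ?Q" if "x \<in> ?Q" for x
    using bij that by (auto dest: bij_betwE)
  have inv: "inv_into ?Q \<gamma> u = w \<longleftrightarrow> u = \<gamma> w" if "u \<in> ?Q" "w \<in> ?Q" for u w
    using bij_betw_inv_into_left[OF bij(3), of w] bij_betw_inv_into_right[OF bij(3), of u] that
    by auto
  have closed: "op x y \<in> ?Q" if "x \<in> ?Q" "y \<in> ?Q" for x y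
    using that bij_betwE[OF bij_betw_inv_into[OF bij(3)]] by (simp add: op mem)
  have uniq: "\<exists>!x. x \<in> ?Q \<and> f x = v" if f: "bij_betw f ?Q ?Q" and v: "v \<in> ?Q" for f v
  proof -
    obtain x where "x \<in> ?Q" "f x = v" using bij_betw_imp_surj_on[OF f] v by (metis imageE)
    then show ?thesis by (intro ex1I[of _ x]) (auto dest: inj_onD[OF bij_betw_imp_inj_on[OF f]])
  qed
  have "\<exists>!x. x \<in> ?Q \<and> op x u = w" if uw: "u \<in> ?Q" "w \<in> ?Q" for u w
  proof -
    have "op x u = w \<longleftrightarrow> \<alpha> x = \<gamma> w \<otimes>\<^bsub>G\<^esub> inv\<^bsub>G\<^esub> \<beta> u" if "x \<in> ?Q" for x
    proof -
      have "op x u = w \<longleftrightarrow> \<alpha> x \<otimes>\<^bsub>G\<^esub> \<beta> u = \<gamma> w" using that uw by (simp add: op inv mem)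
      also have "\<dots> \<longleftrightarrow> \<alpha> x = \<gamma> w \<otimes>\<^bsub>G\<^esub> inv\<^bsub>G\<^esub> \<beta> u"
        using that uw inv_solve_right[of "\<alpha> x" "\<gamma> w" "\<beta> u"] by (metis m_closed mem)
      finally show ?thesis .
    qed
    \<comment> \<open>The equivalence holds only on the carrier; \<open>conj_cong\<close> makes the
      membership available while rewriting below the quantifier.\<close>
    then show ?thesis using uniq[OF bij(1)] uw by (simp add: mem cong: conj_cong)
  qed
  moreover have "\<exists>!y. y \<in> ?Q \<and> op u y = w" if uw: "u \<in> ?Q" "w \<in> ?Q" for u w
  proof -
    have "op u y = w \<longleftrightarrow> \<beta> y = inv\<^bsub>G\<^esub> \<alpha> u \<otimes>\<^bsub>G\<^esub> \<gamma> w" if "y \<in> ?Q" for y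
    proof -
      have "op u y = w \<longleftrightarrow> \<alpha> u \<otimes>\<^bsub>G\<^esub> \<beta> y = \<gamma> w" using that uw by (simp add: op inv mem)
      also have "\<dots> \<longleftrightarrow> \<beta> y = inv\<^bsub>G\<^esub> \<alpha> u \<otimes>\<^bsub>G\<^esub> \<gamma> w"
        using that uw inv_solve_left[of "\<beta> y" "\<alpha> u" "\<gamma> w"] by (metis m_closed mem)
      finally show ?thesis .
    qed
    then show ?thesis using uniq[OF bij(2)] uw by (simp add: mem cong: conj_cong)
  qed
  ultimately show ?thesis using closed by (simp add: quasigroup_def)
qed

section \<open>The identities in terms of a canonical decomposition\<close>

text \<open>Rewriting with \<open>m_assoc\<close> nests products to the right, and an inverse pair
  is then no longer a subterm of its own; these rules cancel it there.\<close>

lemma (in group) mult_inv_cancel [simp]: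
  assumes "x \<in> carrier G" "y \<in> carrier G"
  shows "x \<otimes> (inv x \<otimes> y) = y" and "inv x \<otimes> (x \<otimes> y) = y"
  using assms by (simp_all flip: m_assoc)

lemma (in group) comm_group_if_comm:
  assumes "\<And>x y. x \<in> carrier G \<Longrightarrow> y \<in> carrier G \<Longrightarrow> x \<otimes> y = y \<otimes> x"
  shows "comm_group G"
  by (rule group_comm_groupI) (use assms in auto)

text \<open>Q and the chosen point 0 are absorbed into the carrier and the unit of G, so that the
  simplification rules for groups apply directly.\<close>

locale canonical_isotope = group G for G :: "'a monoid" (structure) +
  fixes op :: "'a \<Rightarrow> 'a \<Rightarrow> 'a" and \<alpha> \<beta> :: "'a \<Rightarrow> 'a" and a :: 'a
  assumes a[simp, intro]: "a \<in> carrier G"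
    and bij_\<alpha>: "bij_betw \<alpha> (carrier G) (carrier G)"
    and bij_\<beta>: "bij_betw \<beta> (carrier G) (carrier G)"
    and \<alpha>_one[simp]: "\<alpha> \<one> = \<one>" and \<beta>_one[simp]: "\<beta> \<one> = \<one>"
    and op_eq: "\<And>x y. x \<in> carrier G \<Longrightarrow> y \<in> carrier G \<Longrightarrow> op x y = \<alpha> x \<otimes> a \<otimes> \<beta> y"
begin

lemma \<alpha>_closed[simp]: "x \<in> carrier G \<Longrightarrow> \<alpha> x \<in> carrier G"
  using bij_\<alpha> by (auto dest: bij_betwE)

lemma \<beta>_closed[simp]: "x \<in> carrier G \<Longrightarrow> \<beta> x \<in> carrier G"
  using bij_\<beta> by (auto dest: bij_betwE)

lemma \<alpha>_surj: "y \<in> carrier G \<Longrightarrow> \<exists>x\<in>carrier G. \<alpha> x = y"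
  using bij_\<alpha> by (metis bij_betw_imp_surj_on imageE)

lemma \<beta>_surj: "y \<in> carrier G \<Longrightarrow> \<exists>x\<in>carrier G. \<beta> x = y"
  using bij_\<beta> by (metis bij_betw_imp_surj_on imageE)

text \<open>Setting one variable to 0 gives a + \<beta> y = \<alpha> y + a, so the product of x and
  y is \<alpha> x + \<alpha> y + a. It is symmetric only if values of \<alpha> commute, and these
  are all elements.\<close>

lemma commutes_iff:
  "(\<forall>x\<in>carrier G. \<forall>y\<in>carrier G. op y x = op x y) \<longleftrightarrow>
    comm_group G \<and> maps_equal (carrier G) \<beta> \<alpha>"
proof
  assume comm: "\<forall>x\<in>carrier G. \<forall>y\<in>carrier G. op y x = op x y"
  have \<beta>: "a \<otimes> \<beta> x = \<alpha> x \<otimes> a" if "x \<in> carrier G" for x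
    using comm that op_eq[of x \<one>] op_eq[of \<one> x] by simp
  have comm': "\<alpha> x \<otimes> \<alpha> y = \<alpha> y \<otimes> \<alpha> x" if "x \<in> carrier G" "y \<in> carrier G" for x y
  proof -
    have "(\<alpha> x \<otimes> \<alpha> y) \<otimes> a = (\<alpha> y \<otimes> \<alpha> x) \<otimes> a"
      using comm that by (simp add: op_eq m_assoc \<beta>)
    then show ?thesis using that by simp
  qed
  have G: "comm_group G"
    by (rule comm_group_if_comm) (metis comm' \<alpha>_surj)
  then interpret comm_group G .
  have "\<beta> x = \<alpha> x" if "x \<in> carrier G" for x
    using \<beta>[OF that] that by (simp add: m_comm[of _ a])
  with G show "comm_group G \<and> maps_equal (carrier G) \<beta> \<alpha>" by simp
next
  assume *: "comm_group G \<and> maps_equal (carrier G) \<beta> \<alpha>"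
  then interpret comm_group G by simp
  show "\<forall>x\<in>carrier G. \<forall>y\<in>carrier G. op y x = op x y"
    using * by (simp add: op_eq m_ac)
qed

lemma left_symmetric_identity_iff:
  "(\<forall>x\<in>carrier G. \<forall>y\<in>carrier G. op x (op x y) = y) \<longleftrightarrow>
    comm_group G \<and> maps_equal (carrier G) \<beta> (\<lambda>x. inv x)"
proof
  assume sym: "\<forall>x\<in>carrier G. \<forall>y\<in>carrier G. op x (op x y) = y"
  \<comment> \<open>Here u = \<alpha> x and z = a + \<beta> y, so the inner product is u + z. The
    right-hand side is the same expression at x = 0, since both products return y.\<close>
  have *: "u \<otimes> a \<otimes> \<beta> (u \<otimes> z) = a \<otimes> \<beta> z" if u: "u \<in> carrier G" and z: "z \<in> carrier G" for u z
  proof -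
    obtain x y where xy: "x \<in> carrier G" "\<alpha> x = u" "y \<in> carrier G" "\<beta> y = inv a \<otimes> z"
      using \<alpha>_surj[OF u] \<beta>_surj[of "inv a \<otimes> z"] z by auto
    have "u \<otimes> a \<otimes> \<beta> (u \<otimes> z) = op x (op x y)"
      using xy u z by (simp add: op_eq m_assoc)
    also have "\<dots> = op \<one> (op \<one> y)" using sym xy by simp
    also have "\<dots> = a \<otimes> \<beta> z"
      using xy z by (simp add: op_eq)
    finally show ?thesis .
  qed
  \<comment> \<open>The case z = 0 of \<open>*\<close>.\<close>
  have \<beta>: "\<beta> u = inv a \<otimes> inv u \<otimes> a" if u: "u \<in> carrier G" for u
    using *[OF u one_closed] u by (simp add: m_assoc inv_solve_left inv_solve_left')
  have inv_hom: "inv u \<otimes> inv z = inv z \<otimes> inv u" if u: "u \<in> carrier G" and z: "z \<in> carrier G" for u z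
  proof -
    have "u \<otimes> a \<otimes> (inv a \<otimes> (inv z \<otimes> inv u) \<otimes> a) = a \<otimes> (inv a \<otimes> inv z \<otimes> a)"
      using *[OF u z] u z by (simp add: \<beta> inv_mult_group)
    then have "u \<otimes> (inv z \<otimes> inv u) \<otimes> a = inv z \<otimes> a"
      using u z by (simp add: m_assoc)
    then have "u \<otimes> (inv z \<otimes> inv u) = inv z" using u z by simp
    then show ?thesis using u z inv_solve_left[of "inv z \<otimes> inv u" u "inv z"] by simp
  qed
  have G: "comm_group G"
    by (rule comm_group_if_comm) (metis inv_hom inv_inv inv_closed)
  then interpret comm_group G .
  have "\<beta> x = inv x" if "x \<in> carrier G" for x
    using that by (simp add: \<beta> m_ac)
  with G show "comm_group G \<and> maps_equal (carrier G) \<beta> (\<lambda>x. inv x)" by simp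
next
  assume *: "comm_group G \<and> maps_equal (carrier G) \<beta> (\<lambda>x. inv x)"
  then interpret comm_group G by simp
  have "u \<otimes> inv (u \<otimes> inv y) = y" if "u \<in> carrier G" "y \<in> carrier G" for u y
    using that by (simp add: inv_mult_group m_comm[of u] m_assoc)
  then show "\<forall>x\<in>carrier G. \<forall>y\<in>carrier G. op x (op x y) = y"
    using * by (simp add: op_eq)
qed

lemma right_symmetric_identity_iff:
  "(\<forall>x\<in>carrier G. \<forall>y\<in>carrier G. op (op x y) y = x) \<longleftrightarrow>
    comm_group G \<and> maps_equal (carrier G) \<alpha> (\<lambda>x. inv x)"
proof
  assume sym: "\<forall>x\<in>carrier G. \<forall>y\<in>carrier G. op (op x y) y = x"
  \<comment> \<open>Mirror image of the left symmetric case, with z = \<alpha> x + a and u = \<beta>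
    y. The conjugation by a now goes the other way: \<alpha> u = a - u - a.\<close>
  have *: "\<alpha> (z \<otimes> u) \<otimes> (a \<otimes> u) = \<alpha> z \<otimes> a" if u: "u \<in> carrier G" and z: "z \<in> carrier G" for u z
  proof -
    obtain x y where xy: "x \<in> carrier G" "\<beta> y = u" "y \<in> carrier G" "\<alpha> x = z \<otimes> inv a"
      using \<beta>_surj[OF u] \<alpha>_surj[of "z \<otimes> inv a"] z by auto
    have "\<alpha> (z \<otimes> u) \<otimes> (a \<otimes> u) = op (op x y) y"
      using xy u z by (simp add: op_eq m_assoc)
    also have "\<dots> = op (op x \<one>) \<one>" using sym xy by simp
    also have "\<dots> = \<alpha> z \<otimes> a"
      using xy z by (simp add: op_eq m_assoc)
    finally show ?thesis .
  qed
  have \<alpha>: "\<alpha> u = a \<otimes> (inv u \<otimes> inv a)" if u: "u \<in> carrier G" for u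
  proof -
    have "\<alpha> u = a \<otimes> inv (a \<otimes> u)" using *[OF u one_closed] u by (simp add: inv_solve_right)
    then show ?thesis using u by (simp add: inv_mult_group)
  qed
  have inv_hom: "inv z \<otimes> inv u = inv u \<otimes> inv z" if u: "u \<in> carrier G" and z: "z \<in> carrier G" for u z
  proof -
    have "a \<otimes> ((inv u \<otimes> inv z) \<otimes> u) = a \<otimes> inv z"
      using *[OF u z] u z by (simp add: \<alpha> inv_mult_group m_assoc)
    then have "(inv u \<otimes> inv z) \<otimes> u = inv z" using u z by simp
    then show ?thesis using u z by (simp add: inv_solve_right')
  qed
  have G: "comm_group G"
    by (rule comm_group_if_comm) (metis inv_hom inv_inv inv_closed)
  then interpret comm_group G .
  have "\<alpha> x = inv x" if "x \<in> carrier G" for x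
    using that by (simp add: \<alpha> m_comm[of "inv x"] flip: m_assoc)
  with G show "comm_group G \<and> maps_equal (carrier G) \<alpha> (\<lambda>x. inv x)" by simp
next
  assume *: "comm_group G \<and> maps_equal (carrier G) \<alpha> (\<lambda>x. inv x)"
  then interpret comm_group G by simp
  have "inv (inv x \<otimes> u) \<otimes> u = x" if "u \<in> carrier G" "x \<in> carrier G" for u x
    using that by (simp add: inv_mult_group m_assoc m_comm[of x u])
  then show "\<forall>x\<in>carrier G. \<forall>y\<in>carrier G. op (op x y) y = x"
    using * by (simp add: op_eq m_assoc)
qed

lemma inv_into_inner_map:
  assumes "x \<in> carrier G"
  shows "inv_into (carrier G) (inner_map G a) x = a \<otimes> x \<otimes> inv a"
proof (rule inv_into_f_eq)
  show "inj_on (inner_map G a) (carrier G)"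
    by (rule inj_onI) (simp add: inner_map_def)
  show "inner_map G a (a \<otimes> x \<otimes> inv a) = x"
    using assms by (simp add: inner_map_def m_assoc)
qed (use assms in simp)

text \<open>These clauses occur in the semi-symmetric case and, negated, in the asymmetric one. As a
  single proposition they leave the final equivalences propositional.\<close>

definition semi_symmetric_data :: bool where
  "semi_symmetric_data \<longleftrightarrow>
    anti_automorphism G \<alpha> \<and> maps_equal (carrier G) \<beta> (inv_into (carrier G) \<alpha>) \<and>
    \<alpha> a = inv a \<and>
    maps_equal (carrier G) (\<alpha> ^^ 3) (\<lambda>x. inv (inv_into (carrier G) (inner_map G a) x))"

lemma semi_symmetric_identity_iff:
  "(\<forall>x\<in>carrier G. \<forall>y\<in>carrier G. op y (op x y) = x) \<longleftrightarrow> semi_symmetric_data"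
proof
  assume sym: "\<forall>x\<in>carrier G. \<forall>y\<in>carrier G. op y (op x y) = x"
  \<comment> \<open>With z = \<alpha> x + a the inner product is z + \<beta> y. Both sides equal x,
    the right one as the value at y = 0.\<close>
  have *: "\<alpha> y \<otimes> a \<otimes> \<beta> (z \<otimes> \<beta> y) = a \<otimes> \<beta> z" if y: "y \<in> carrier G" and z: "z \<in> carrier G" for y z
  proof -
    obtain x where x: "x \<in> carrier G" "\<alpha> x = z \<otimes> inv a"
      using \<alpha>_surj[of "z \<otimes> inv a"] z by auto
    have "\<alpha> y \<otimes> a \<otimes> \<beta> (z \<otimes> \<beta> y) = op y (op x y)"
      using x y z by (simp add: op_eq m_assoc)
    also have "\<dots> = op \<one> (op x \<one>)" using sym x y by simp
    also have "\<dots> = a \<otimes> \<beta> z" using x z by (simp add: op_eq m_assoc)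
    finally show ?thesis .
  qed
  have x0: "a \<otimes> \<beta> (\<alpha> x \<otimes> a) = x" if "x \<in> carrier G" for x
    using sym[rule_format, OF that one_closed] that by (simp add: op_eq)
  have \<beta>\<beta>: "\<alpha> y \<otimes> a \<otimes> \<beta> (\<beta> y) = a" if "y \<in> carrier G" for y
    using *[OF that one_closed] that by simp
  \<comment> \<open>By \<open>\<beta>\<beta>\<close> the right-hand side of \<open>*\<close> is
    \<alpha> y + a + \<beta>(\<beta> y) + \<beta> z. Cancelling \<alpha> y + a leaves the sum in
    reversed order.\<close>
  have \<beta>_anti: "\<beta> (z \<otimes> w) = \<beta> w \<otimes> \<beta> z" if z: "z \<in> carrier G" and w: "w \<in> carrier G" for z w
  proof -
    obtain y where y: "y \<in> carrier G" "\<beta> y = w" using \<beta>_surj[OF w] by auto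
    have "\<alpha> y \<otimes> a \<otimes> \<beta> (z \<otimes> w) = \<alpha> y \<otimes> a \<otimes> \<beta> (\<beta> y) \<otimes> \<beta> z"
      using *[OF y(1) z] \<beta>\<beta>[OF y(1)] y by simp
    then show ?thesis using y z w by (simp add: m_assoc)
  qed
  have \<beta>a: "\<beta> a = inv a"
    using x0[OF one_closed] by simp (metis a \<beta>_closed inv_comm inv_equality)
  \<comment> \<open>By \<open>x0\<close>, \<beta>(\<alpha> x + a) = -a + x; the anti-homomorphism
    law makes the left side \<beta> a + \<beta>(\<alpha> x), and \<beta> a = -a cancels.\<close>
  have \<beta>\<alpha>: "\<beta> (\<alpha> x) = x" if "x \<in> carrier G" for x
    using x0[OF that] that by (simp add: \<beta>_anti \<beta>a flip: m_assoc)
  have \<alpha>\<beta>: "\<alpha> (\<beta> x) = x" if "x \<in> carrier G" for x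
    using \<beta>\<alpha> \<alpha>_surj[OF that] by auto
  have \<alpha>_anti: "\<alpha> (x \<otimes> y) = \<alpha> y \<otimes> \<alpha> x" if "x \<in> carrier G" "y \<in> carrier G" for x y
    using \<beta>_anti[of "\<alpha> y" "\<alpha> x"] that \<alpha>\<beta>[of "\<alpha> y \<otimes> \<alpha> x"] by (simp add: \<beta>\<alpha>)
  have "\<alpha> a \<otimes> a = \<one>"
    using \<alpha>_anti[of "inv a" a] \<beta>a \<alpha>\<beta>[OF a] by simp
  then have \<alpha>a: "\<alpha> a = inv a" by (simp add: inv_equality)
  have \<alpha>3: "(\<alpha> ^^ 3) x = inv (a \<otimes> x \<otimes> inv a)" if "x \<in> carrier G" for x
  proof -
    \<comment> \<open>\<open>\<beta>\<beta>\<close> at y = \<alpha>(\<alpha> x), where the two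
      applications of \<beta> undo those of \<alpha>.\<close>
    have "\<alpha> (\<alpha> (\<alpha> x)) \<otimes> a \<otimes> x = a"
      using \<beta>\<beta>[of "\<alpha> (\<alpha> x)"] that by (simp add: \<beta>\<alpha>)
    then have "\<alpha> (\<alpha> (\<alpha> x)) \<otimes> a = a \<otimes> inv x"
      using that inv_solve_right[of "\<alpha> (\<alpha> (\<alpha> x)) \<otimes> a" a x] by simp
    then have "\<alpha> (\<alpha> (\<alpha> x)) = a \<otimes> inv x \<otimes> inv a"
      using that inv_solve_right[of "\<alpha> (\<alpha> (\<alpha> x))" "a \<otimes> inv x" a] by simp
    then show ?thesis using that by (simp add: numeral_3_eq_3 inv_mult_group m_assoc)
  qed
  have "\<beta> x = inv_into (carrier G) \<alpha> x" if "x \<in> carrier G" for x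
    using bij_\<alpha> that \<alpha>\<beta> by (metis \<beta>_closed bij_betw_inv_into_left)
  then show semi_symmetric_data
    using \<alpha>a \<alpha>_anti \<alpha>3 bij_\<alpha>
    by (simp add: semi_symmetric_data_def anti_automorphism_def inv_into_inner_map)
next
  assume data: semi_symmetric_data
  have \<alpha>\<beta>: "\<alpha> (\<beta> x) = x" if "x \<in> carrier G" for x
    using data that bij_\<alpha> by (simp add: semi_symmetric_data_def bij_betw_inv_into_right)
  have \<beta>\<alpha>: "\<beta> (\<alpha> x) = x" if "x \<in> carrier G" for x
    using data that bij_\<alpha> by (simp add: semi_symmetric_data_def bij_betw_inv_into_left)
  have \<alpha>_anti: "\<alpha> (x \<otimes> y) = \<alpha> y \<otimes> \<alpha> x" if "x \<in> carrier G" "y \<in> carrier G" for x y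
    using data that by (simp add: semi_symmetric_data_def anti_automorphism_def)
  have \<beta>_anti: "\<beta> (x \<otimes> y) = \<beta> y \<otimes> \<beta> x" if "x \<in> carrier G" "y \<in> carrier G" for x y
    using \<alpha>_anti[of "\<beta> y" "\<beta> x"] that \<beta>\<alpha>[of "\<beta> y \<otimes> \<beta> x"] by (simp add: \<alpha>\<beta>)
  have "\<beta> (inv a) = a" using data \<beta>\<alpha>[OF a] by (simp add: semi_symmetric_data_def)
  then have "\<beta> a \<otimes> a = \<one>" using \<beta>_anti[of "inv a" a] by simp
  then have \<beta>a: "\<beta> a = inv a" by (simp add: inv_equality)
  have \<alpha>3: "(\<alpha> ^^ 3) x = inv (a \<otimes> x \<otimes> inv a)" if "x \<in> carrier G" for x
    using data that by (simp add: semi_symmetric_data_def inv_into_inner_map)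
  have \<beta>\<beta>: "\<alpha> y \<otimes> a \<otimes> \<beta> (\<beta> y) \<otimes> inv a = \<one>" if y: "y \<in> carrier G" for y
  proof -
    \<comment> \<open>The argument \<beta>(\<beta> y) cancels two of the three applications of
      \<alpha>, which recovers the relation found in the other direction.\<close>
    have "(\<alpha> ^^ 3) (\<beta> (\<beta> y)) = inv (a \<otimes> \<beta> (\<beta> y) \<otimes> inv a)"
      using \<alpha>3 y by simp
    then have "\<alpha> y = inv (a \<otimes> \<beta> (\<beta> y) \<otimes> inv a)" using y by (simp add: numeral_3_eq_3 \<alpha>\<beta>)
    then have "\<alpha> y \<otimes> (a \<otimes> \<beta> (\<beta> y) \<otimes> inv a) = \<one>" using y by simp
    then show ?thesis using y by (simp add: m_assoc)
  qed
  show "\<forall>x\<in>carrier G. \<forall>y\<in>carrier G. op y (op x y) = x"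
  proof (intro ballI)
    fix x y assume x: "x \<in> carrier G" and y: "y \<in> carrier G"
    \<comment> \<open>Order reversal by \<beta> moves \<beta>(\<beta> y) to the front, next to
      \<alpha> y + a, and \<open>\<beta>\<beta>\<close> then removes everything but x.\<close>
    have "op y (op x y) = \<alpha> y \<otimes> a \<otimes> (\<beta> (\<beta> y) \<otimes> (inv a \<otimes> x))"
      using x y by (simp add: op_eq \<beta>_anti \<beta>a \<beta>\<alpha>)
    also have "\<dots> = (\<alpha> y \<otimes> a \<otimes> \<beta> (\<beta> y) \<otimes> inv a) \<otimes> x" using x y by (simp add: m_assoc)
    also have "\<dots> = x" using \<beta>\<beta>[OF y] x by simp
    finally show "op y (op x y) = x" .
  qed
qed

text \<open>Since \<beta> inverts \<alpha>, and -\<iota> is its own inverse, the condition on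
  \<alpha> passes to \<beta>. In the semi-symmetric case, total symmetry therefore means only that G
  is abelian and \<alpha> = -\<iota>.\<close>

lemma semi_symmetric_data_inverse:
  assumes semi_symmetric_data and "maps_equal (carrier G) \<alpha> (\<lambda>x. inv x)"
  shows "maps_equal (carrier G) \<beta> (\<lambda>x. inv x)"
proof
  fix x assume x: "x \<in> carrier G"
  then have "\<alpha> (\<beta> x) = x"
    using assms(1) bij_\<alpha> by (simp add: semi_symmetric_data_def bij_betw_inv_into_right)
  with assms(2) x have "inv (\<beta> x) = x" by simp
  with x show "\<beta> x = inv x" by (metis \<beta>_closed inv_inv)
qed

end

section \<open>The six characterisations and the partition\<close>

theorem mainTheorem2:
  fixes Q :: "'a set"
  shows
    "(\<forall>op z G \<alpha> a \<beta>.
        group_isotope Q op \<and> z \<in> Q \<and> canonical_decomposition Q op z G \<alpha> a \<beta> \<longrightarrow>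
          ((strictly commutative Q op \<longleftrightarrow> Sym Q op = {id, perm_s}) \<and>
           (strictly commutative Q op \<longleftrightarrow>
              comm_group G \<and> maps_equal Q \<beta> \<alpha> \<and> \<not> maps_equal Q \<alpha> (\<lambda>x. inv\<^bsub>G\<^esub> x))) \<and>
          ((strictly left_symmetric Q op \<longleftrightarrow> Sym Q op = {id, perm_r}) \<and>
           (strictly left_symmetric Q op \<longleftrightarrow>
              comm_group G \<and> maps_equal Q \<beta> (\<lambda>x. inv\<^bsub>G\<^esub> x) \<and>
              \<not> maps_equal Q \<alpha> (\<lambda>x. inv\<^bsub>G\<^esub> x))) \<and>
          ((strictly right_symmetric Q op \<longleftrightarrow> Sym Q op = {id, perm_l}) \<and>
           (strictly right_symmetric Q op \<longleftrightarrow>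
              comm_group G \<and> maps_equal Q \<alpha> (\<lambda>x. inv\<^bsub>G\<^esub> x) \<and>
              \<not> maps_equal Q \<beta> (\<lambda>x. inv\<^bsub>G\<^esub> x))) \<and>
          ((strictly semi_symmetric Q op \<longleftrightarrow> Sym Q op = carrier (alt_group 3)) \<and>
           (strictly semi_symmetric Q op \<longleftrightarrow>
              anti_automorphism G \<alpha> \<and> maps_equal Q \<beta> (inv_into Q \<alpha>) \<and> \<alpha> a = inv\<^bsub>G\<^esub> a \<and>
              maps_equal Q (\<alpha> ^^ 3) (\<lambda>x. inv\<^bsub>G\<^esub> (inv_into Q (inner_map G a) x)) \<and>
              (\<not> comm_group G \<or> \<not> maps_equal Q \<alpha> (\<lambda>x. inv\<^bsub>G\<^esub> x)))) \<and>
          ((totally_symmetric Q op \<longleftrightarrow> Sym Q op = carrier (sym_group 3)) \<and>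
           (totally_symmetric Q op \<longleftrightarrow>
              comm_group G \<and> maps_equal Q \<alpha> \<beta> \<and> maps_equal Q \<beta> (\<lambda>x. inv\<^bsub>G\<^esub> x))) \<and>
          ((asymmetric Q op \<longleftrightarrow> Sym Q op = {id}) \<and>
           (asymmetric Q op \<longleftrightarrow>
              (\<not> anti_automorphism G \<alpha> \<or> \<not> maps_equal Q \<beta> (inv_into Q \<alpha>) \<or>
               \<not> maps_equal Q (\<alpha> ^^ 3) (\<lambda>x. inv\<^bsub>G\<^esub> (inv_into Q (inner_map G a) x)) \<or>
               \<alpha> a \<noteq> inv\<^bsub>G\<^esub> a) \<and>
              (\<not> comm_group G \<or>
               (\<not> maps_equal Q \<alpha> (\<lambda>x. inv\<^bsub>G\<^esub> x) \<and> \<not> maps_equal Q \<alpha> \<beta> \<and>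
                \<not> maps_equal Q \<beta> (\<lambda>x. inv\<^bsub>G\<^esub> x)))))) \<and>
     (\<forall>H :: 'a monoid. group H \<and> carrier H = Q \<longrightarrow>
        (\<Union>i<6. {op \<in> isotopes H. (symmetry_classes ! i) Q op}) = isotopes H \<and>
        disjoint_family_on (\<lambda>i. {op \<in> isotopes H. (symmetry_classes ! i) Q op}) {..<6})"
proof (intro conjI allI impI)
  fix op :: "'a \<Rightarrow> 'a \<Rightarrow> 'a" and z and G :: "'a monoid" and \<alpha> a \<beta>
  assume *: "group_isotope Q op \<and> z \<in> Q \<and> canonical_decomposition Q op z G \<alpha> a \<beta>"
  then have Q: "quasigroup Q op"
    using isotope_of_group_quasigroup by (auto simp: group_isotope_def)
  have G: "carrier G = Q" using * by (simp add: canonical_decomposition_def)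
  interpret canonical_isotope G op \<alpha> \<beta> a
    using * by (auto simp: canonical_decomposition_def canonical_isotope_def
        canonical_isotope_axioms_def)
  let ?comm = "comm_group G"
  let ?\<alpha>\<beta> = "maps_equal Q \<alpha> \<beta>"
  let ?\<alpha> = "maps_equal Q \<alpha> (\<lambda>x. inv\<^bsub>G\<^esub> x)"
  let ?\<beta> = "maps_equal Q \<beta> (\<lambda>x. inv\<^bsub>G\<^esub> x)"
  have \<beta>\<alpha>: "maps_equal Q \<beta> \<alpha> \<longleftrightarrow> ?\<alpha>\<beta>" by auto
  have s: "perm_s \<in> Sym Q op \<longleftrightarrow> ?comm \<and> ?\<alpha>\<beta>"
    unfolding commutative_iff[OF Q] commutes_iff[unfolded G] \<beta>\<alpha> ..
  have r: "perm_r \<in> Sym Q op \<longleftrightarrow> ?comm \<and> ?\<beta>"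
    unfolding left_symmetric_iff[OF Q] left_symmetric_identity_iff[unfolded G] ..
  have l: "perm_l \<in> Sym Q op \<longleftrightarrow> ?comm \<and> ?\<alpha>"
    unfolding right_symmetric_iff[OF Q] right_symmetric_identity_iff[unfolded G] ..
  have c: "perm_s \<circ> perm_r \<in> Sym Q op \<longleftrightarrow> semi_symmetric_data"
    unfolding rotation_iff[OF Q] semi_symmetric_identity_iff[unfolded G] ..
  \<comment> \<open>Any two of \<alpha> = \<beta>, \<alpha> = -\<iota>, \<beta> = -\<iota> imply the
    third. This is why one inequality in each strict class excludes total symmetry.\<close>
  have eqs: "?\<alpha>\<beta> \<Longrightarrow> ?\<alpha> \<longleftrightarrow> ?\<beta>" "?\<alpha> \<Longrightarrow> ?\<beta> \<Longrightarrow> ?\<alpha>\<beta>" by auto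
  have data_eq: "semi_symmetric_data \<Longrightarrow> ?\<alpha> \<Longrightarrow> ?\<beta>"
    using semi_symmetric_data_inverse unfolding G .
  have tot: "totally_symmetric Q op \<longleftrightarrow> ?comm \<and> ?\<alpha>\<beta> \<and> ?\<beta>"
    using totally_symmetric_iff[OF Q] s r by argo
  note iffs = strict_classes_iff[OF Q]
  show "strictly commutative Q op \<longleftrightarrow> Sym Q op = {id, perm_s}"
    "strictly left_symmetric Q op \<longleftrightarrow> Sym Q op = {id, perm_r}"
    "strictly right_symmetric Q op \<longleftrightarrow> Sym Q op = {id, perm_l}"
    "strictly semi_symmetric Q op \<longleftrightarrow> Sym Q op = carrier (alt_group 3)"
    by (fact iffs)+
  show "totally_symmetric Q op \<longleftrightarrow> Sym Q op = carrier (sym_group 3)"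
    by (fact totally_symmetric_def)
  show "asymmetric Q op \<longleftrightarrow> Sym Q op = {id}"
    by (fact asymmetric_def)
  show "strictly commutative Q op \<longleftrightarrow> ?comm \<and> maps_equal Q \<beta> \<alpha> \<and> \<not> ?\<alpha>"
    unfolding strictly_def commutative_def s tot \<beta>\<alpha> using eqs by argo
  show "strictly left_symmetric Q op \<longleftrightarrow> ?comm \<and> ?\<beta> \<and> \<not> ?\<alpha>"
    unfolding strictly_def left_symmetric_def r tot using eqs by argo
  show "strictly right_symmetric Q op \<longleftrightarrow> ?comm \<and> ?\<alpha> \<and> \<not> ?\<beta>"
    unfolding strictly_def right_symmetric_def l tot using eqs by argo
  have "strictly semi_symmetric Q op \<longleftrightarrow> semi_symmetric_data \<and> (\<not> ?comm \<or> \<not> ?\<alpha>)"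
    unfolding strictly_def semi_symmetric_iff[OF Q] c tot using eqs data_eq by argo
  then show "strictly semi_symmetric Q op \<longleftrightarrow>
      anti_automorphism G \<alpha> \<and> maps_equal Q \<beta> (inv_into Q \<alpha>) \<and> \<alpha> a = inv\<^bsub>G\<^esub> a \<and>
      maps_equal Q (\<alpha> ^^ 3) (\<lambda>x. inv\<^bsub>G\<^esub> (inv_into Q (inner_map G a) x)) \<and>
      (\<not> ?comm \<or> \<not> ?\<alpha>)"
    unfolding semi_symmetric_data_def G by argo
  show "totally_symmetric Q op \<longleftrightarrow> ?comm \<and> ?\<alpha>\<beta> \<and> ?\<beta>" by (fact tot)
  have "asymmetric Q op \<longleftrightarrow>
      \<not> semi_symmetric_data \<and> (\<not> ?comm \<or> (\<not> ?\<alpha> \<and> \<not> ?\<alpha>\<beta> \<and> \<not> ?\<beta>))"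
    unfolding asymmetric_iff[OF Q] s r l c by argo
  then show "asymmetric Q op \<longleftrightarrow>
      (\<not> anti_automorphism G \<alpha> \<or> \<not> maps_equal Q \<beta> (inv_into Q \<alpha>) \<or>
       \<not> maps_equal Q (\<alpha> ^^ 3) (\<lambda>x. inv\<^bsub>G\<^esub> (inv_into Q (inner_map G a) x)) \<or>
       \<alpha> a \<noteq> inv\<^bsub>G\<^esub> a) \<and>
      (\<not> ?comm \<or> (\<not> ?\<alpha> \<and> \<not> ?\<alpha>\<beta> \<and> \<not> ?\<beta>))"
    unfolding semi_symmetric_data_def G by argo
next
  fix H :: "'a monoid"
  assume "group H \<and> carrier H = Q"
  \<comment> \<open>The partition reflects the list of subgroups of S_3: every isotope is a
    quasigroup, and its symmetry group is exactly one of the six.\<close>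
  then have Q: "quasigroup Q op" if "op \<in> isotopes H" for op
    using that isotope_of_group_quasigroup by (auto simp: isotopes_def)
  show "(\<Union>i<6. {op \<in> isotopes H. (symmetry_classes ! i) Q op}) = isotopes H"
    using symmetry_classes_cover[OF Q] by auto
  show "disjoint_family_on (\<lambda>i. {op \<in> isotopes H. (symmetry_classes ! i) Q op}) {..<6}"
    using symmetry_classes_disjoint[OF Q] by (auto simp: disjoint_family_on_def)
qed

end
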